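(* Let $\mathbf r,\mathbf a\in\mathbb R^3$ with $|\mathbf a|>|\mathbf r|>0$, and put $\mathbf r'=\mathbf r+\mathbf a$, $r=|\mathbf r|$, $r'=|\mathbf r'|$. For integers $l\ge 0$, $|m|\le l$, $1\le\lambda\le l$, $|\mu|\le\lambda$ let $$A_{l,\lambda}^{m,\mu}(\mathbf a)=\sqrt{\frac{2l+1}{2\lambda+1}}\sqrt{\binom{l+m}{\lambda+\mu}\binom{l-m}{\lambda-\mu}}\;R_{l-\lambda}^{m-\mu}(\mathbf a),$$ and define $$A_{l,\lambda}^{[m],\mu}=\begin{cases}\frac1{\sqrt2}\big(A_{l,\lambda}^{-m,\mu}(\mathbf a)+(-1)^mA_{l,\lambda}^{m,\mu}(\mathbf a)\big),&m>0,\\ A_{l,\lambda}^{0,\mu}(\mathbf a),&m=0,\\ \frac{i}{\sqrt2}\big(A_{l,\lambda}^{m,\mu}(\mathbf a)-(-1)^mA_{l,\lambda}^{-m,\mu}(\mathbf a)\big),&m<0.\end{cases}$$ Then for all $l\ge0$ and $|m|\le l$ the real vector spherical harmonic $W_{lm}$ satisfies $$r'^{\,l-1}W_{lm}(\hat{\mathbf r}')=\sum_{\lambda=1}^{l}\sum_{\mu=-\lambda}^{\lambda}r^{\lambda-1}A_{l,\lambda}^{[m],\mu}\,W_\lambda^\mu(\hat{\mathbf r})$$ $$=\sum_{\lambda=1}^{l}r^{\lambda-1}\Big\{\sum_{\mu=-\lambda}^{-1}\tfrac1{\sqrt2}A_{l,\lambda}^{[m],\mu}\big[W_{\lambda,-\mu}(\hat{\mathbf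 r})-iW_{\lambda,\mu}(\hat{\mathbf r})\big]+\sum_{\mu=1}^{\lambda}\tfrac{(-1)^\mu}{\sqrt2}A_{l,\lambda}^{[m],\mu}\big[W_{\lambda,\mu}(\hat{\mathbf r})+iW_{\lambda,-\mu}(\hat{\mathbf r})\big]+A_{l,\lambda}^{[m],0}W_{\lambda,0}(\hat{\mathbf r})\Big\}.$$
   Context: For nonzero $\mathbf r$, $\hat{\mathbf r}=\mathbf r/|\mathbf r|$. $Y_l^m$ ($l\ge0$, $|m|\le l$) are the standard $L^2$-orthonormal complex spherical harmonics on the unit sphere with Condon–Shortley phase. Real spherical harmonics: $Y_{lm}=\frac1{\sqrt2}(Y_l^{-m}+(-1)^mY_l^m)$ for $m>0$, $Y_{l0}=Y_l^0$, $Y_{lm}=\frac{i}{\sqrt2}(Y_l^m-(-1)^mY_l^{-m})$ for $m<0$. With $\nabla_S$ the surface gradient on the unit sphere, the real vector spherical harmonic is $W_{lm}=\nabla_SY_{lm}+lY_{lm}\hat{\mathbf r}$ and the complex one is $W_l^m=\nabla_SY_l^m+lY_l^m\hat{\mathbf r}$. Regular solid harmonics: $R_l^m(\mathbf r)=\sqrt{\frac{4\pi}{2l+1}}\,|\mathbf r|^lY_l^m(\hat{\mathbf r})$, with $R_l^m=0$ if $|m|>l$; binomial coefficients $\binom{N}{k}$ vanish for $k<0$ or $k>N$. *)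

theory Defs
  imports "HOL-Analysis.Analysis" "HOL-Computational_Algebra.Polynomial"
begin

subsection \<open>Complex spherical harmonics\<close>

text \<open>Rodrigues' formula: \<open>P_l(x) = 1/(2^l l!) (d/dx)^l (x^2 - 1)^l\<close>.\<close>

definition legendre_poly :: "nat \<Rightarrow> real poly" where
  "legendre_poly l = smult (1 / (2 ^ l * fact l)) ((pderiv ^^ l) ([:-1, 0, 1:] ^ l))"

text \<open>
  Associated Legendre functions, including the Condon--Shortley factor \<open>(-1)^m\<close>:
  \<open>P_l^m(x) = (-1)^m (1 - x^2)^(m/2) (d/dx)^m P_l(x)\<close> for \<open>m \<ge> 0\<close>, continued to negative
  order by \<open>P_l^(-m) = (-1)^m (l-m)!/(l+m)! P_l^m\<close>.
\<close>

definition assoc_legendre_nonneg :: "nat \<Rightarrow> nat \<Rightarrow> real \<Rightarrow> real" where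
  "assoc_legendre_nonneg l m x =
     (-1) ^ m * sqrt (1 - x\<^sup>2) ^ m * poly ((pderiv ^^ m) (legendre_poly l)) x"

definition assoc_legendre :: "nat \<Rightarrow> int \<Rightarrow> real \<Rightarrow> real" where
  "assoc_legendre l m x =
     (if 0 \<le> m then assoc_legendre_nonneg l (nat m) x
      else (-1) ^ nat (- m) * fact (nat (int l + m)) / fact (nat (int l - m))
             * assoc_legendre_nonneg l (nat (- m)) x)"

definition sph_harm_angles :: "nat \<Rightarrow> int \<Rightarrow> real \<Rightarrow> real \<Rightarrow> complex" where
  "sph_harm_angles l m \<theta> \<phi> =
     of_real (sqrt ((2 * real l + 1) / (4 * pi) * fact (nat (int l - m)) / fact (nat (int l + m)))
                * assoc_legendre l m (cos \<theta>))
     * cis (of_int m * \<phi>)"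

text \<open>
  \<open>Y_l^m\<close> as a function on the unit sphere, meaningful for \<open>\<bar>m\<bar> \<le> l\<close>, through the polar angle
  \<open>\<theta> = arccos n_3\<close> and the azimuth \<open>\<phi>\<close> of \<open>(n_1, n_2)\<close>.  At the poles \<open>Arg 0 = 0\<close>; the choice
  is immaterial, since there only \<open>m = 0\<close> gives a nonzero value.
\<close>

definition sph_harm :: "nat \<Rightarrow> int \<Rightarrow> real^3 \<Rightarrow> complex" where
  "sph_harm l m n = sph_harm_angles l m (arccos (n $ 3)) (Arg (Complex (n $ 1) (n $ 2)))"

subsection \<open>Real spherical harmonics\<close>

text \<open>
  The real harmonics are kept complex-typed, because their definition and the identities mixing
  them with the complex ones live over the complex numbers; \<open>real_sph_harm_Reals\<close> below confirms
  that they are real-valued.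
\<close>

definition real_sph_harm :: "nat \<Rightarrow> int \<Rightarrow> real^3 \<Rightarrow> complex" where
  "real_sph_harm l m n =
     (if m > 0 then 1 / of_real (sqrt 2) * (sph_harm l (- m) n + (-1) powi m * sph_harm l m n)
      else if m = 0 then sph_harm l 0 n
      else \<i> / of_real (sqrt 2) * (sph_harm l m n - (-1) powi m * sph_harm l (- m) n))"

lemma sph_harm_uminus:
  assumes "\<bar>m\<bar> \<le> int l"
  shows "sph_harm l (- m) n = (-1) powi m * cnj (sph_harm l m n)"
proof -
  have pos: "sph_harm l (- int k) n = (-1) ^ k * cnj (sph_harm l (int k) n)" if "k \<le> l" for k
  proof -
    define a b where "a = (fact (l - k) :: real)" and "b = (fact (l + k) :: real)"
    have ab: "a > 0" "b > 0" by (simp_all add: a_def b_def)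
    define c where "c = (2 * real l + 1) / (4 * pi)"
    have c: "c > 0" by (simp add: c_def)
    have q: "sqrt (c * b / a) * (a / b) = sqrt (c * a / b)"
    proof -
      have "a / b = sqrt ((a / b)\<^sup>2)" using ab by simp
      then have "sqrt (c * b / a) * (a / b) = sqrt ((c * b / a) * (a / b)\<^sup>2)"
        by (metis real_sqrt_mult)
      also have "(c * b / a) * (a / b)\<^sup>2 = c * a / b"
        using ab by (simp add: power2_eq_square)
      finally show ?thesis .
    qed
    show ?thesis
    proof (cases "k = 0")
      case True
      then show ?thesis
        by (simp add: sph_harm_def sph_harm_angles_def)
    next
      case False
      have n1: "nat (int l - int k) = l - k" "nat (int l + int k) = l + k" using that by auto
      have "assoc_legendre l (- int k) x = (-1) ^ k * (a / b) * assoc_legendre_nonneg l k x" for x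
        using False by (simp add: assoc_legendre_def n1 a_def b_def)
      moreover have "assoc_legendre l (int k) x = assoc_legendre_nonneg l k x" for x
        by (simp add: assoc_legendre_def)
      ultimately show ?thesis
        by (simp add: sph_harm_def sph_harm_angles_def n1 cis_cnj
              flip: a_def b_def c_def q)
    qed
  qed
  have cc: "(-1::complex) ^ k * ((-1) ^ k * z) = z" for k z
    by (simp flip: mult.assoc power_mult_distrib)
  show ?thesis
  proof (cases "m \<ge> 0")
    case True
    then show ?thesis using pos[of "nat m"] assms by (simp add: power_int_def)
  next
    case False
    have "sph_harm l m n = (-1) ^ nat (- m) * cnj (sph_harm l (- m) n)"
      using pos[of "nat (- m)"] assms False by simp
    then show ?thesis
      using False by (simp add: power_int_def cc)
  qed
qed

lemma real_sph_harm_Reals: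
  assumes "\<bar>m\<bar> \<le> int l"
  shows "real_sph_harm l m n \<in> \<real>"
proof -
  have s: "(-1::complex) powi m * ((-1) powi m * z) = z" for z
    by (simp flip: mult.assoc power_int_mult_distrib)
  have c: "cnj ((-1) powi m) = (-1) powi m"
    by (simp add: power_int_def)
  have "cnj (sph_harm l 0 n) = sph_harm l 0 n"
    using sph_harm_uminus[of 0 l n] by simp
  then have "cnj (real_sph_harm l m n) = real_sph_harm l m n"
    by (simp add: real_sph_harm_def sph_harm_uminus[OF assms] c s algebra_simps)
  then show ?thesis by (simp add: Reals_cnj_iff)
qed

subsection \<open>Surface gradient and vector spherical harmonics\<close>

text \<open>
  The surface gradient at \<open>n\<close> of a complex function on the unit sphere is the tangential vector
  that represents its differential along the sphere.  The derivative is taken within the sphere,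
  so only the values of \<open>f\<close> there matter.  The pairing is bilinear, without conjugation, so that
  this is the complex-linear extension of the gradient of real functions.
\<close>

definition pairing :: "complex^3 \<Rightarrow> real^3 \<Rightarrow> complex" where
  "pairing v h = (\<Sum>j\<in>UNIV. v $ j * of_real (h $ j))"

definition is_surface_gradient :: "(real^3 \<Rightarrow> complex) \<Rightarrow> real^3 \<Rightarrow> complex^3 \<Rightarrow> bool" where
  "is_surface_gradient f n v \<longleftrightarrow>
     pairing v n = 0 \<and> (f has_derivative pairing v) (at n within sphere 0 1)"

definition surface_gradient :: "(real^3 \<Rightarrow> complex) \<Rightarrow> real^3 \<Rightarrow> complex^3" where
  "surface_gradient f n = (THE v. is_surface_gradient f n v)"

lemma is_surface_gradient_unique:
  assumes n: "norm n = 1" and v: "is_surface_gradient f n v" and w: "is_surface_gradient f n w"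
  shows "v = w"
proof -
  have add: "pairing u (x + y) = pairing u x + pairing u y" for u x y
    by (simp add: pairing_def algebra_simps sum.distrib)
  have scale: "pairing u (c *\<^sub>R x) = of_real c * pairing u x" for u c x
    by (simp add: pairing_def sum_distrib_left mult_ac)
  have unit: "pairing v t = pairing w t" if t: "norm t = 1" "n \<bullet> t = 0" for t
  proof -
    define c where "c = (\<lambda>s::real. cos s *\<^sub>R n + sin s *\<^sub>R t)"
    have c0: "c 0 = n" by (simp add: c_def)
    have sph: "c ` UNIV \<subseteq> sphere 0 1"
    proof -
      have "c s \<bullet> c s = 1" for s
      proof -
        have "n \<bullet> n = 1" "t \<bullet> t = 1" using n t by (simp_all add: norm_eq_1)
        then have "c s \<bullet> c s = (cos s)\<^sup>2 + (sin s)\<^sup>2"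
          using t by (simp add: c_def inner_simps inner_commute power2_eq_square)
        then show ?thesis by simp
      qed
      then show ?thesis by (auto simp: norm_eq_1)
    qed
    have dc: "(c has_derivative (\<lambda>s. s *\<^sub>R t)) (at 0 within UNIV)"
      unfolding c_def by (auto intro!: derivative_eq_intros)
    have "((\<lambda>s. f (c s)) has_derivative (\<lambda>s. pairing u (s *\<^sub>R t))) (at 0)"
      if "is_surface_gradient f n u" for u
    proof -
      have "(f has_derivative pairing u) (at (c 0) within c ` UNIV)"
        using that sph has_derivative_subset unfolding is_surface_gradient_def c0 by blast
      from has_derivative_in_compose[OF dc this] show ?thesis by simp
    qed
    from has_derivative_unique[OF this[OF v] this[OF w]]
    have "pairing v (1 *\<^sub>R t) = pairing w (1 *\<^sub>R t)" by metis
    then show ?thesis by simp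
  qed
  have tang: "pairing v t = pairing w t" if "n \<bullet> t = 0" for t
  proof (cases "t = 0")
    case True then show ?thesis by (simp add: pairing_def)
  next
    case False
    then have "pairing v (sgn t) = pairing w (sgn t)"
      using that by (intro unit) (simp_all add: norm_sgn sgn_div_norm)
    then show ?thesis using False by (simp add: sgn_div_norm scale)
  qed
  have all: "pairing v h = pairing w h" for h
  proof -
    have "n \<bullet> (h - (n \<bullet> h) *\<^sub>R n) = 0" using n by (simp add: inner_simps norm_eq_1)
    then have "pairing v (h - (n \<bullet> h) *\<^sub>R n) = pairing w (h - (n \<bullet> h) *\<^sub>R n)" by (rule tang)
    moreover have "pairing v n = pairing w n" using v w by (simp add: is_surface_gradient_def)
    moreover have "h = (h - (n \<bullet> h) *\<^sub>R n) + (n \<bullet> h) *\<^sub>R n" by simp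
    ultimately show ?thesis by (metis add scale)
  qed
  have "pairing u (axis j 1) = u $ j" for u j
    by (simp add: pairing_def axis_def if_distrib cong: if_cong)
  with all show ?thesis by (metis vec_eq_iff)
qed

lemma surface_gradient_eqI:
  "norm n = 1 \<Longrightarrow> is_surface_gradient f n v \<Longrightarrow> surface_gradient f n = v"
  unfolding surface_gradient_def by (blast intro: the_equality is_surface_gradient_unique)

text \<open>\<open>\<nabla>_S Y + l Y n\<close> at the unit vector \<open>n\<close>.\<close>

definition vector_harm :: "nat \<Rightarrow> (real^3 \<Rightarrow> complex) \<Rightarrow> real^3 \<Rightarrow> complex^3" where
  "vector_harm l Y n = surface_gradient Y n + (of_nat l * Y n) *s (\<chi> j. of_real (n $ j))"

definition W_complex :: "nat \<Rightarrow> int \<Rightarrow> real^3 \<Rightarrow> complex^3" where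
  "W_complex l m = vector_harm l (sph_harm l m)"

definition W_real :: "nat \<Rightarrow> int \<Rightarrow> real^3 \<Rightarrow> complex^3" where
  "W_real l m = vector_harm l (real_sph_harm l m)"

subsection \<open>Regular solid harmonics and translation coefficients\<close>

definition solid_harm :: "nat \<Rightarrow> int \<Rightarrow> real^3 \<Rightarrow> complex" where
  "solid_harm l m r =
     (if \<bar>m\<bar> \<le> int l
      then of_real (sqrt (4 * pi / (2 * real l + 1)) * norm r ^ l) * sph_harm l m (sgn r)
      else 0)"

text \<open>Binomial coefficients with integer arguments vanish outside \<open>0 \<le> k \<le> N\<close>.\<close>

definition binom :: "int \<Rightarrow> int \<Rightarrow> real" where
  "binom N k = (if 0 \<le> k \<and> k \<le> N then real (nat N choose nat k) else 0)"

text \<open>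
  The degree \<open>\<lambda>\<close> is written \<open>k\<close>.  Used only for \<open>k \<le> l\<close>, so that the subtraction in
  \<open>l - k\<close> does not truncate.
\<close>

definition trans_coeff :: "nat \<Rightarrow> nat \<Rightarrow> int \<Rightarrow> int \<Rightarrow> real^3 \<Rightarrow> complex" where
  "trans_coeff l k m \<mu> a =
     of_real (sqrt ((2 * real l + 1) / (2 * real k + 1))
       * sqrt (binom (int l + m) (int k + \<mu>) * binom (int l - m) (int k - \<mu>)))
     * solid_harm (l - k) (m - \<mu>) a"

definition trans_coeff_real :: "nat \<Rightarrow> nat \<Rightarrow> int \<Rightarrow> int \<Rightarrow> real^3 \<Rightarrow> complex" where
  "trans_coeff_real l k m \<mu> a =
     (if m > 0 then 1 / of_real (sqrt 2)
        * (trans_coeff l k (- m) \<mu> a + (-1) powi m * trans_coeff l k m \<mu> a)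
      else if m = 0 then trans_coeff l k 0 \<mu> a
      else \<i> / of_real (sqrt 2)
        * (trans_coeff l k m \<mu> a - (-1) powi m * trans_coeff l k (- m) \<mu> a))"

end

theory Submission
  imports Defs
begin

text \<open>
  The solid harmonic \<open>\<bar>r\<bar>^l Y_l^m(r / \<bar>r\<bar>)\<close> is a polynomial in the coordinates of \<open>r\<close>, and its
  gradient at \<open>r\<close> is \<open>\<bar>r\<bar>^(l-1) W_l^m(r / \<bar>r\<bar>)\<close>: the tangential part of the gradient is
  \<open>\<nabla>_S Y\<close>, and the radial part is \<open>l Y\<close> by Euler's identity for homogeneous functions.
  The claim is therefore the gradient of the addition theorem for solid harmonics.  The term of degree
  \<open>0\<close> is constant in \<open>r\<close>, which is why the sum over degrees starts at \<open>1\<close>.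
  
  The addition theorem becomes the binomial theorem once the solid harmonics are collected in a
  generating function.  With \<open>w = (x + i y) / 2\<close>, put
  \<open>q(r) = cnj w / t + z - w t\<close>, a Laurent polynomial in \<open>t\<close> whose coefficients are linear in
  \<open>r = (x, y, z)\<close>.  Then
  \<open>q(r)^l / l! = (\<Sum>m. t^m R_l^m(r) / sqrt ((l+m)! (l-m)!))\<close>, and since
  \<open>q(r + a) = q(r) + q(a)\<close>, the coefficients of \<open>q(r + a)^l\<close> are convolutions of those of
  \<open>q(r)^k\<close> and \<open>q(a)^(l-k)\<close> (\<open>trinomial_add\<close>).  The square roots of factorials combine to the
  square roots of binomial coefficients in the translation coefficients
  (\<open>sqrt_fact_ratio\<close>, \<open>harm_poly_add\<close>).
  
  That this generating function produces the harmonics given by Rodrigues' formula is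
  \<open>sph_harm_eq_harm_poly\<close>.  On the unit sphere \<open>4 w cnj w = 1 - z^2\<close>, so after the substitution
  \<open>u = - 2 w t\<close> the function \<open>q^l\<close> becomes, up to a monomial factor, the Taylor expansion
  \<open>((z + u)^2 - 1)^l\<close> of \<open>(x^2 - 1)^l\<close> about \<open>z\<close>, whose coefficients are, up to factorials, the derivatives that define the
  associated Legendre functions.
  
  The real harmonics are fixed linear combinations of \<open>Y_l^m\<close> and \<open>Y_l^(-m)\<close>, and the operation
  \<open>Y \<mapsto> \<nabla>_S Y + l Y n\<close> is linear.  Both equalities for the real vector harmonics then follow
  from the complex translation formula \<open>W_complex_translation\<close> by taking these combinations and
  inverting them.
\<close>

section \<open>Coefficients of powers of a Laurent trinomial\<close>

text \<open>
  The coefficient of \<open>t^m\<close> in \<open>(b / t + c + a t)^l\<close>.  Multiplication by \<open>t^l\<close> turns the Laurent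
  polynomial into an ordinary one and shifts the index by \<open>l\<close>.
\<close>

definition trinomial :: "'a::comm_ring_1 \<Rightarrow> 'a \<Rightarrow> 'a \<Rightarrow> nat \<Rightarrow> int \<Rightarrow> 'a" where
  "trinomial b c a l m = (if 0 \<le> int l + m then coeff ([:b, c, a:] ^ l) (nat (int l + m)) else 0)"

lemma trinomial_0: "trinomial b c a 0 m = (if m = 0 then 1 else 0)"
  by (auto simp: trinomial_def)

text \<open>
  Since the index \<open>m\<close> ranges over all integers, this recursion has no boundary case at the lowest
  coefficient, and identities for trinomial coefficients follow from it by induction on \<open>l\<close>.
\<close>

lemma trinomial_Suc:
  "trinomial b c a (Suc l) m
     = b * trinomial b c a l (m + 1) + c * trinomial b c a l m + a * trinomial b c a l (m - 1)"
proof -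
  define P where "P = [:b, c, a:] ^ l"
  have S: "[:b, c, a:] ^ Suc l = smult b P + pCons 0 (smult c P + pCons 0 (smult a P))"
    by (simp add: P_def)
  consider "int l + m < -1" | "int l + m = -1" | "int l + m = 0" | j where "int l + m = int (Suc j)"
  proof (cases "int l + m \<ge> 1")
    case True
    then have "int l + m = int (Suc (nat (int l + m - 1)))" by simp
    then show ?thesis by (rule that(4))
  qed (use that in linarith)
  then show ?thesis
  proof cases
    case 1
    then show ?thesis by (simp add: trinomial_def)
  next
    case 2
    then show ?thesis
      using S by (simp add: trinomial_def P_def)
  next
    case 3
    then have "m = - int l" by simp
    then show ?thesis
      unfolding trinomial_def S by (simp add: flip: P_def)
  next
    case 4
    then have n: "nat (int (Suc l) + m) = Suc (Suc j)" "nat (int l + m) = Suc j"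
      "nat (int l + (m + 1)) = Suc (Suc j)" "nat (int l + (m - 1)) = j" by auto
    show ?thesis
      unfolding trinomial_def S n using 4 by (simp flip: P_def)
  qed
qed

lemma trinomial_outside: "int l < \<bar>m\<bar> \<Longrightarrow> trinomial b c a l m = 0"
  by (induction l arbitrary: m) (auto simp: trinomial_0 trinomial_Suc)

lemma trinomial_smult:
  "trinomial (s * b) (s * c) (s * a) l m = s ^ l * trinomial b c a l m"
  by (induction l arbitrary: m) (auto simp: trinomial_0 trinomial_Suc algebra_simps)

lemma of_real_trinomial:
  "complex_of_real (trinomial b c a l m) = trinomial (of_real b) (of_real c) (of_real a) l m"
  by (induction l arbitrary: m) (auto simp: trinomial_0 trinomial_Suc)

text \<open>
  Replacing \<open>t\<close> by \<open>- 1 / cnj t\<close> conjugates the trinomial \<open>cnj w / t + z - w t\<close> when \<open>z\<close> is real.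
  For the harmonics this is the relation between the orders \<open>m\<close> and \<open>- m\<close>.
\<close>

lemma trinomial_cnj:
  "trinomial (cnj w) (of_real z) (- w) l (- m) = (-1) powi m * cnj (trinomial (cnj w) (of_real z) (- w) l m)"
proof (induction l arbitrary: m)
  case 0
  then show ?case by (simp add: trinomial_0)
next
  case (Suc l)
  have e: "- m + 1 = - (m - 1)" "- m - 1 = - (m + 1)" by simp_all
  have p: "(-1::complex) powi (m - 1) = - ((-1) powi m)" "(-1::complex) powi (m + 1) = - ((-1) powi m)"
    by (simp_all add: power_int_diff power_int_add)
  show ?case
    unfolding trinomial_Suc e Suc.IH p by (simp add: algebra_simps)
qed

text \<open>
  The substitution \<open>u = a t\<close> makes the leading coefficient \<open>1\<close>.  The two conjuncts both say that the
  coefficients differ by the factor \<open>a^m\<close>, arranged such that \<open>a\<close> is never inverted: for the harmonics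
  \<open>a\<close> is \<open>0\<close> at the poles of the sphere.  The induction needs both signs of \<open>m\<close>, because the recursion at \<open>m = 0\<close> involves \<open>1\<close> and \<open>-1\<close>.
\<close>

lemma trinomial_normalise:
  "(0 \<le> m \<longrightarrow> trinomial b c a l m = a ^ nat m * trinomial (a * b) c 1 l m)
   \<and> (m \<le> 0 \<longrightarrow> a ^ nat (- m) * trinomial b c a l m = trinomial (a * b) c 1 l m)"
proof (induction l arbitrary: m)
  case 0
  then show ?case by (simp add: trinomial_0)
next
  case (Suc l)
  consider "m = 0" | k where "m = int (Suc k)" | k where "m = - int (Suc k)"
    by (metis int_cases2 not0_implies_Suc of_nat_0 minus_zero)
  then show ?case
  proof cases
    case 1
    then show ?thesis using Suc.IH[of 1] Suc.IH[of 0] Suc.IH[of "-1"]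
      by (simp add: trinomial_Suc algebra_simps)
  next
    case (2 k)
    have e: "nat (m + 1) = Suc (Suc k)" "nat m = Suc k" "nat (m - 1) = k" using 2 by auto
    show ?thesis using Suc.IH[of "m + 1"] Suc.IH[of m] Suc.IH[of "m - 1"] 2
      unfolding e by (simp add: trinomial_Suc e algebra_simps)
  next
    case (3 k)
    have e: "nat (- (m + 1)) = k" "nat (- m) = Suc k" "nat (- (m - 1)) = Suc (Suc k)" using 3 by auto
    have "a ^ nat (- m) * trinomial b c a (Suc l) m =
        a * b * (a ^ k * trinomial b c a l (m + 1)) + c * (a ^ Suc k * trinomial b c a l m)
        + a ^ Suc (Suc k) * trinomial b c a l (m - 1)"
      unfolding trinomial_Suc e by (simp add: algebra_simps)
    also have "\<dots> = trinomial (a * b) c 1 (Suc l) m"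
      using Suc.IH[of "m + 1"] Suc.IH[of m] Suc.IH[of "m - 1"] 3 
      unfolding e trinomial_Suc by simp
    finally show ?thesis using 3 by auto
  qed
qed

text \<open>
  The binomial theorem for \<open>p + q\<close>, where each coefficient of \<open>p^k q^(l-k)\<close> is a Cauchy product.  The
  Cauchy product runs over the indices up to \<open>l + m\<close>; the difference between this range and
  \<open>\<bar>\<mu>\<bar> \<le> k\<close> consists of vanishing terms.
\<close>

lemma trinomial_add:
  "trinomial (b + b') (c + c') (a + a') l m
     = (\<Sum>k\<le>l. \<Sum>\<mu>=-int k..int k.
          of_nat (l choose k) * (trinomial b c a k \<mu> * trinomial b' c' a' (l - k) (m - \<mu>)))"
proof (cases "0 \<le> int l + m")
  case False
  have "trinomial b c a k \<mu> * trinomial b' c' a' (l - k) (m - \<mu>) = 0" if "k \<le> l" for k \<mu>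
  proof -
    have "int k < \<bar>\<mu>\<bar> \<or> int (l - k) < \<bar>m - \<mu>\<bar>" using False that by linarith
    then show ?thesis by (auto simp: trinomial_outside)
  qed
  then show ?thesis using False by (simp add: trinomial_outside)
next
  case True
  define N where "N = nat (int l + m)"
  define p q where "p = [:b, c, a:]" and "q = [:b', c', a':]"
  have inner: "coeff (p ^ k * q ^ (l - k)) N
      = (\<Sum>\<mu>=-int k..int k. trinomial b c a k \<mu> * trinomial b' c' a' (l - k) (m - \<mu>))"
    if k: "k \<le> l" for k
  proof -
    have "coeff (p ^ k * q ^ (l - k)) N
        = (\<Sum>i\<le>N. trinomial b c a k (int i - int k) * trinomial b' c' a' (l - k) (m - (int i - int k)))"
      unfolding coeff_mult
    proof (rule sum.cong[OF refl])
      fix i assume "i \<in> {..N}"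
      then have "int i \<le> int l + m" using True by (auto simp: N_def)
      then have "nat (int (l - k) + (m - (int i - int k))) = N - i"
        "0 \<le> int (l - k) + (m - (int i - int k))" using k by (auto simp: N_def)
      then show "coeff (p ^ k) i * coeff (q ^ (l - k)) (N - i)
         = trinomial b c a k (int i - int k) * trinomial b' c' a' (l - k) (m - (int i - int k))"
        by (simp add: trinomial_def p_def q_def)
    qed
    also have "\<dots> = (\<Sum>\<mu>=-int k..int N - int k. trinomial b c a k \<mu> * trinomial b' c' a' (l - k) (m - \<mu>))"
      by (rule sum.reindex_bij_witness[of _ "\<lambda>\<mu>. nat (\<mu> + int k)" "\<lambda>i. int i - int k"]) auto
    also have "\<dots> = (\<Sum>\<mu>=-int k..int k. trinomial b c a k \<mu> * trinomial b' c' a' (l - k) (m - \<mu>))"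
    proof (rule sum.mono_neutral_cong)
      show "trinomial b c a k \<mu> * trinomial b' c' a' (l - k) (m - \<mu>) = 0"
        if "\<mu> \<in> {-int k..int N - int k} - {-int k..int k}" for \<mu>
      proof -
        have "int k < \<bar>\<mu>\<bar>" using that by auto
        then show ?thesis by (simp add: trinomial_outside)
      qed
      show "trinomial b c a k \<mu> * trinomial b' c' a' (l - k) (m - \<mu>) = 0"
        if "\<mu> \<in> {-int k..int k} - {-int k..int N - int k}" for \<mu>
      proof -
        have "int (l - k) < \<bar>m - \<mu>\<bar>" using that k True by (auto simp: N_def)
        then show ?thesis by (simp add: trinomial_outside)
      qed
    qed auto
    finally show ?thesis .
  qed
  have "trinomial (b + b') (c + c') (a + a') l m = coeff ((p + q) ^ l) N"
    using True by (simp add: trinomial_def N_def p_def q_def)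
  also have "\<dots> = (\<Sum>k\<le>l. of_nat (l choose k) * coeff (p ^ k * q ^ (l - k)) N)"
    by (simp add: binomial_ring coeff_sum mult.assoc of_nat_poly)
  finally show ?thesis by (simp add: inner sum_distrib_left)
qed

section \<open>Legendre functions as trinomial coefficients\<close>

text \<open>
  Taylor's formula for polynomials.
\<close>

lemma coeff_shift_eq_higher_pderiv:
  "fact j * coeff (pcompose p [:c, 1:]) j = poly ((pderiv ^^ j) p) (c::real)"
proof -
  have "(pderiv ^^ j) (pcompose p [:c, 1:]) = pcompose ((pderiv ^^ j) p) [:c, 1:]" for p :: "real poly"
    by (induction j) (simp_all add: pderiv_pcompose pderiv_pCons)
  then have "poly ((pderiv ^^ j) p) c = poly ((pderiv ^^ j) (pcompose p [:c, 1:])) 0"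
    by (simp add: poly_pcompose)
  also have "\<dots> = fact j * coeff (pcompose p [:c, 1:]) j"
    by (simp add: poly_0_coeff_0 coeff_higher_pderiv pochhammer_fact)
  finally show ?thesis by simp
qed

lemma pcompose_power: "pcompose (p ^ n) q = pcompose p q ^ n" for p :: "'a::comm_semiring_1 poly"
  by (induction n) (simp_all add: pcompose_mult pcompose_1)

text \<open>
  By Rodrigues' formula the left-hand side is a derivative of order \<open>l + m\<close> of \<open>(x^2 - 1)^l\<close>, and
  \<open>(c + u)^2 - 1 = (c^2 - 1) + 2 c u + u^2\<close>.
\<close>

lemma legendre_derivative_eq_trinomial:
  "poly ((pderiv ^^ m) (legendre_poly l)) c
     = fact (l + m) / (2 ^ l * fact l) * trinomial (c\<^sup>2 - 1) (2 * c) 1 l (int m)"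
proof -
  have "[:-1, 0, 1:] \<circ>\<^sub>p [:c, 1:] = [:c\<^sup>2 - 1, 2 * c, 1:]"
    by (simp add: pcompose_pCons power2_eq_square)
  then have shift: "[:-1, 0, 1:] ^ l \<circ>\<^sub>p [:c, 1:] = [:c\<^sup>2 - 1, 2 * c, 1:] ^ l"
    by (simp only: pcompose_power)
  have "(pderiv ^^ m) (legendre_poly l) = smult (1 / (2 ^ l * fact l)) ((pderiv ^^ (l + m)) ([:-1, 0, 1:] ^ l))"
    by (simp only: legendre_poly_def higher_pderiv_smult add.commute[of l m] funpow_add comp_apply)
  then have "poly ((pderiv ^^ m) (legendre_poly l)) c
      = 1 / (2 ^ l * fact l) * (fact (l + m) * coeff ([:c\<^sup>2 - 1, 2 * c, 1:] ^ l) (l + m))"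
    by (simp only: poly_smult coeff_shift_eq_higher_pderiv[symmetric] shift)
  moreover have "nat (int l + int m) = l + m" by simp
  ultimately show ?thesis by (simp only: trinomial_def) simp
qed

section \<open>Solid harmonics as polynomials\<close>

definition half_xy :: "real^3 \<Rightarrow> complex" where
  "half_xy r = Complex (r $ 1 / 2) (r $ 2 / 2)"

text \<open>
  The solid harmonic \<open>R_l^m\<close> in terms of its generating function.  For \<open>\<bar>m\<bar> > l\<close> the trinomial
  coefficient makes it vanish, as it should.
\<close>

definition harm_poly :: "nat \<Rightarrow> int \<Rightarrow> real^3 \<Rightarrow> complex" where
  "harm_poly l m r =
     of_real (sqrt (fact (nat (int l + m)) * fact (nat (int l - m))) / fact l)
     * trinomial (cnj (half_xy r)) (of_real (r $ 3)) (- half_xy r) l m"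

lemma harm_poly_uminus: "harm_poly l (- m) r = (-1) powi m * cnj (harm_poly l m r)"
  by (simp add: harm_poly_def trinomial_cnj mult.commute)

lemma norm_eq_1_coords: "norm (n :: real^3) = 1 \<longleftrightarrow> (n $ 1)\<^sup>2 + (n $ 2)\<^sup>2 + (n $ 3)\<^sup>2 = 1"
  by (simp add: norm_eq_1 inner_vec_def sum_3 power2_eq_square)

text \<open>
  For \<open>m = k \<ge> 0\<close>, with \<open>W = x + i y\<close>, the trinomial is normalised by \<open>u = - W t\<close> (after pulling out the
  factor \<open>2^l\<close>); its lowest coefficient becomes \<open>- W cnj W = z^2 - 1\<close>, so that the Legendre derivative
  appears, while the factor \<open>(- W)^k\<close> supplies the Condon--Shortley sign, \<open>(1 - z^2)^(k/2)\<close> and the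
  azimuthal phase.  Negative orders follow since both sides have the same conjugation symmetry.
\<close>

lemma sph_harm_eq_harm_poly:
  assumes n: "norm n = 1" and m: "\<bar>m\<bar> \<le> int l"
  shows "sph_harm l m n = of_real (sqrt ((2 * real l + 1) / (4 * pi))) * harm_poly l m n"
proof -
  define C where "C = sqrt ((2 * real l + 1) / (4 * pi))"
  have nonneg: "sph_harm l (int k) n = of_real C * harm_poly l (int k) n" if k: "k \<le> l" for k
  proof -
    define W z where "W = Complex (n $ 1) (n $ 2)" and "z = n $ 3"
    define T where "T = trinomial (z\<^sup>2 - 1) (2 * z) 1 l (int k)"
    define f g where "f = (fact (l + k) :: real)" and "g = (fact (l - k) :: real)"
    have fg: "f > 0" "g > 0" by (simp_all add: f_def g_def)
    have W: "half_xy n = W / 2" by (simp add: half_xy_def W_def complex_eq_iff)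
    have n1: "(n $ 1)\<^sup>2 + (n $ 2)\<^sup>2 + z\<^sup>2 = 1" using n by (simp add: norm_eq_1_coords z_def)
    have z1: "\<bar>z\<bar> \<le> 1"
      using n component_le_norm_cart[of n 3] by (simp add: z_def)
    then have cz: "cos (arccos z) = z" by (simp add: abs_le_iff)
    have mod: "sqrt (1 - z\<^sup>2) = cmod W"
      using n1 by (simp add: W_def cmod_def flip: n1)
    have polar: "of_real (cmod W ^ k) * cis (of_int (int k) * Arg W) = W ^ k"
    proof -
      have "W ^ k = (of_real (cmod W) * cis (Arg W)) ^ k"
        by (metis rcis_cmod_Arg rcis_def)
      then show ?thesis by (simp add: power_mult_distrib Complex.DeMoivre)
    qed
    have WW: "- W * cnj W = of_real (z\<^sup>2 - 1)"
      using n1 by (simp add: W_def complex_eq_iff power2_eq_square)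
    have "2 ^ l * trinomial (cnj (W / 2)) (of_real z) (- (W / 2)) l (int k)
        = trinomial (cnj W) (of_real (2 * z)) (- W) l (int k)"
      by (simp flip: trinomial_smult)
    also have "\<dots> = (- W) ^ k * of_real T"
      using trinomial_normalise[of "int k" "cnj W" "of_real (2 * z)" "- W" l]
      unfolding WW T_def of_real_trinomial by simp
    finally have tri: "trinomial (cnj (W / 2)) (of_real z) (- (W / 2)) l (int k)
        = (- W) ^ k * of_real T / 2 ^ l"
      by (simp add: field_simps)
    have leg: "assoc_legendre l (int k) z = (-1) ^ k * cmod W ^ k * (f / (2 ^ l * fact l) * T)"
      by (simp add: assoc_legendre_def assoc_legendre_nonneg_def legendre_derivative_eq_trinomial
          mod T_def f_def)
    \<comment> \<open>The factorial \<open>(l + k)!\<close> from Taylor's formula turns the normalisation of \<open>Y_l^k\<close> into that of \<open>harm_poly\<close>.\<close>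
    have root: "sqrt ((2 * real l + 1) / (4 * pi) * g / f) * f = C * sqrt (f * g)"
    proof -
      have "f * g = g / f * f\<^sup>2" using fg by (simp add: power2_eq_square)
      then have "sqrt (f * g) = sqrt (g / f) * f" using fg by (simp only: real_sqrt_mult) simp
      then show ?thesis by (simp add: C_def real_sqrt_mult real_sqrt_divide)
    qed
    have nats: "nat (int l - int k) = l - k" "nat (int l + int k) = l + k" using k by auto
    have "sph_harm l (int k) n
        = of_real (sqrt ((2 * real l + 1) / (4 * pi) * g / f) * assoc_legendre l (int k) z)
          * cis (of_int (int k) * Arg W)"
      unfolding sph_harm_def sph_harm_angles_def nats
      by (simp add: cz f_def g_def flip: z_def W_def)
    also have "\<dots> = of_real ((sqrt ((2 * real l + 1) / (4 * pi) * g / f) * f) * (-1) ^ k * T / (2 ^ l * fact l))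
          * (of_real (cmod W ^ k) * cis (of_int (int k) * Arg W))"
      unfolding leg by (simp add: field_simps)
    also have "\<dots> = of_real C * (of_real (sqrt (f * g) / fact l) * ((- W) ^ k * of_real T / 2 ^ l))"
      unfolding root polar by (simp add: power_minus[of W] field_simps)
    also have "\<dots> = of_real C * harm_poly l (int k) n"
      by (simp only: harm_poly_def nats W f_def g_def tri[unfolded z_def])
    finally show ?thesis .
  qed
  show ?thesis
  proof (cases "m \<ge> 0")
    case True
    then show ?thesis using nonneg[of "nat m"] m by (simp add: C_def)
  next
    case False
    have "sph_harm l m n = (-1) powi (- m) * cnj (sph_harm l (- m) n)"
      using sph_harm_uminus[of "- m" l n] m by simp
    moreover have "harm_poly l m n = (-1) powi (- m) * cnj (harm_poly l (- m) n)"
      using harm_poly_uminus[of l "- m" n] by simp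
    moreover have "sph_harm l (- m) n = of_real C * harm_poly l (- m) n"
      using nonneg[of "nat (- m)"] False m by simp
    ultimately show ?thesis by (simp add: C_def)
  qed
qed

lemma half_xy_linear: "half_xy (x + y) = half_xy x + half_xy y" "half_xy (s *\<^sub>R x) = of_real s * half_xy x"
  by (simp_all add: half_xy_def complex_eq_iff add_divide_distrib)

lemma harm_poly_outside: "int l < \<bar>m\<bar> \<Longrightarrow> harm_poly l m r = 0"
  by (simp add: harm_poly_def trinomial_outside)

lemma harm_poly_scaleR: "harm_poly l m (s *\<^sub>R r) = of_real s ^ l * harm_poly l m r"
  using trinomial_smult[of "of_real s" "cnj (half_xy r)" "of_real (r $ 3)" "- half_xy r" l m]
  by (simp add: harm_poly_def half_xy_linear mult_ac)

lemma harm_poly_degree_0: "harm_poly 0 m r = (if m = 0 then 1 else 0)"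
  by (simp add: harm_poly_def trinomial_0)

lemma harm_poly_differentiable: "harm_poly l m differentiable (at r)"
proof -
  have lin: "(\<lambda>r. r $ 3 :: complex) differentiable at r" "(\<lambda>r. half_xy r) differentiable at r"
     "(\<lambda>r. cnj (half_xy r)) differentiable at r" for r :: "real^3"
  proof -
    have "bounded_linear half_xy"
      unfolding linear_conv_bounded_linear[symmetric]
      by (rule linearI) (rule half_xy_linear, metis half_xy_linear(2) scaleR_conv_of_real)
    then show "(\<lambda>r. half_xy r) differentiable at r" "(\<lambda>r. cnj (half_xy r)) differentiable at r"
      by (auto intro: bounded_linear_imp_differentiable bounded_linear_compose[OF bounded_linear_cnj])
    show "(\<lambda>r. of_real (r $ 3) :: complex) differentiable at r"
      by (intro bounded_linear_imp_differentiable
          bounded_linear_compose[OF bounded_linear_of_real bounded_linear_vec_nth])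
  qed
  have "(\<lambda>r. trinomial (cnj (half_xy r)) (of_real (r $ 3)) (- half_xy r) l m) differentiable at r"
    by (induction l arbitrary: m)
       (auto simp: trinomial_0 trinomial_Suc intro!: derivative_intros differentiable_add
         differentiable_mult differentiable_minus lin)
  then show ?thesis
    unfolding harm_poly_def by (intro differentiable_mult differentiable_const)
qed

section \<open>Addition theorem\<close>

text \<open>
  Passing from the unnormalised coefficients, which convolve with weight \<open>l choose k\<close>, to the normalised
  harmonics turns this weight into the square roots of binomial coefficients.
\<close>

lemma sqrt_fact_ratio:
  assumes "k \<le> l" "\<bar>m\<bar> \<le> int l" "\<bar>\<mu>\<bar> \<le> int k" "\<bar>m - \<mu>\<bar> \<le> int (l - k)"
  shows "sqrt (fact (nat (int l + m)) * fact (nat (int l - m))) / fact l * real (l choose k)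
    = sqrt (binom (int l + m) (int k + \<mu>) * binom (int l - m) (int k - \<mu>))
      * (sqrt (fact (nat (int k + \<mu>)) * fact (nat (int k - \<mu>))) / fact k)
      * (sqrt (fact (nat (int (l - k) + (m - \<mu>))) * fact (nat (int (l - k) - (m - \<mu>)))) / fact (l - k))"
proof -
  have b: "binom N j * (fact (nat j) * fact (nat (N - j))) = fact (nat N)" if "0 \<le> j" "j \<le> N" for N j
  proof -
    have "nat (N - j) = nat N - nat j" "nat j \<le> nat N" using that by auto
    then show ?thesis using that by (simp add: binom_def binomial_fact)
  qed
  have e: "int (l - k) + (m - \<mu>) = (int l + m) - (int k + \<mu>)"
    "int (l - k) - (m - \<mu>) = (int l - m) - (int k - \<mu>)" using assms by auto
  have up: "fact (nat (int l + m)) = binom (int l + m) (int k + \<mu>)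
      * (fact (nat (int k + \<mu>)) * fact (nat (int (l - k) + (m - \<mu>))))"
    unfolding e using assms e by (intro b[symmetric]) linarith+
  have down: "fact (nat (int l - m)) = binom (int l - m) (int k - \<mu>)
      * (fact (nat (int k - \<mu>)) * fact (nat (int (l - k) - (m - \<mu>))))"
    unfolding e using assms e by (intro b[symmetric]) linarith+
  have choose: "real (l choose k) = fact l / (fact k * fact (l - k))"
    using assms(1) by (simp add: binomial_fact)
  have "sqrt (B * (x * y) * (B' * (x' * y'))) / fact l * (fact l / (fact k * fact (l - k)))
      = sqrt (B * B') * (sqrt (x * x') / fact k) * (sqrt (y * y') / fact (l - k))" for B B' x x' y y' :: real
    by (simp add: real_sqrt_mult mult_ac)
  then show ?thesis unfolding up down choose .
qed

lemma harm_poly_add: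
  assumes "\<bar>m\<bar> \<le> int l"
  shows "harm_poly l m (r + a)
     = (\<Sum>k\<le>l. \<Sum>\<mu>=-int k..int k.
          of_real (sqrt (binom (int l + m) (int k + \<mu>) * binom (int l - m) (int k - \<mu>)))
          * harm_poly (l - k) (m - \<mu>) a * harm_poly k \<mu> r)"
  unfolding harm_poly_def[of l m "r + a"] half_xy_linear complex_cnj_add vector_add_component
    of_real_add minus_add_distrib trinomial_add sum_distrib_left
proof (intro sum.cong refl)
  fix k \<mu> assume "k \<in> {..l}" "\<mu> \<in> {-int k..int k}"
  then have k: "k \<le> l" "\<bar>\<mu>\<bar> \<le> int k" by auto
  let ?T = "\<lambda>r. trinomial (cnj (half_xy r)) (complex_of_real (r $ 3)) (- half_xy r)"
  show "complex_of_real (sqrt (fact (nat (int l + m)) * fact (nat (int l - m))) / fact l)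
      * (of_nat (l choose k) * (?T r k \<mu> * ?T a (l - k) (m - \<mu>)))
    = of_real (sqrt (binom (int l + m) (int k + \<mu>) * binom (int l - m) (int k - \<mu>)))
          * harm_poly (l - k) (m - \<mu>) a * harm_poly k \<mu> r"
  proof (cases "\<bar>m - \<mu>\<bar> \<le> int (l - k)")
    case True
    show ?thesis
      using arg_cong[OF sqrt_fact_ratio[OF k(1) assms k(2) True], of "\<lambda>x. complex_of_real x * (?T r k \<mu> * ?T a (l - k) (m - \<mu>))"]
      by (simp add: harm_poly_def mult_ac)
  next
    case False
    then show ?thesis by (simp add: trinomial_outside harm_poly_outside)
  qed
qed

section \<open>Gradients of homogeneous functions\<close>

lemma pairing_add_left: "pairing (u + v) h = pairing u h + pairing v h"
  by (simp add: pairing_def algebra_simps sum.distrib)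

lemma pairing_smult_left: "pairing (c *s v) h = c * pairing v h"
  by (simp add: pairing_def sum_distrib_left mult_ac)

lemma pairing_sum_left: "pairing (\<Sum>i\<in>I. v i) h = (\<Sum>i\<in>I. pairing (v i) h)"
  by (induction I rule: infinite_finite_induct) (simp_all add: pairing_add_left, simp_all add: pairing_def)

lemma pairing_scaleR_right: "pairing v (c *\<^sub>R h) = of_real c * pairing v h"
  by (simp add: pairing_def sum_distrib_left mult_ac)

lemma pairing_axis: "pairing v (axis j 1) = v $ j"
  by (simp add: pairing_def axis_def if_distrib cong: if_cong)

text \<open>
  As for the surface gradient, the components stay complex and represent the differential through
  \<open>pairing\<close>, without conjugation; this is the complex-linear extension of the gradient of real functions.
\<close>

definition gradient :: "(real^3 \<Rightarrow> complex) \<Rightarrow> real^3 \<Rightarrow> complex^3" where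
  "gradient F x = (\<chi> j. frechet_derivative F (at x) (axis j 1))"

lemma has_derivative_gradient:
  assumes "F differentiable at x"
  shows "(F has_derivative pairing (gradient F x)) (at x)"
proof -
  let ?D = "frechet_derivative F (at x)"
  have D: "(F has_derivative ?D) (at x)" using assms by (simp add: frechet_derivative_works)
  then have lin: "linear ?D" by (rule has_derivative_linear)
  have "pairing (gradient F x) h = ?D h" for h
  proof -
    have "?D h = ?D (\<Sum>j\<in>UNIV. (h $ j) *\<^sub>R axis j 1)"
      by (simp add: basis_expansion flip: scalar_mult_eq_scaleR)
    also have "\<dots> = (\<Sum>j\<in>UNIV. (h $ j) *\<^sub>R ?D (axis j 1))"
      by (simp only: linear_sum[OF lin] linear_cmul[OF lin])
    finally have "?D h = (\<Sum>j\<in>UNIV. (h $ j) *\<^sub>R ?D (axis j 1))" .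
    then show ?thesis by (simp add: pairing_def gradient_def scaleR_conv_of_real mult.commute)
  qed
  then have "pairing (gradient F x) = ?D" ..
  with D show ?thesis by simp
qed

lemma gradient_eqI:
  assumes "(F has_derivative pairing v) (at x)"
  shows "gradient F x = v"
  using frechet_derivative_at[OF assms] by (metis gradient_def pairing_axis vec_lambda_unique)

text \<open>
  Euler's identity: both sides are the derivative of \<open>s \<mapsto> F (s x)\<close> at \<open>s = 1\<close>.
\<close>

lemma homogeneous_euler:
  assumes F: "F differentiable at x" and hom: "\<And>s x. F (s *\<^sub>R x) = of_real s ^ l * F x"
  shows "pairing (gradient F x) x = of_nat l * F x"
proof -
  have d: "((\<lambda>s. s *\<^sub>R x) has_derivative (\<lambda>s. s *\<^sub>R x)) (at 1)"
    by (auto intro!: derivative_eq_intros)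
  have "(F has_derivative pairing (gradient F x)) (at (1 *\<^sub>R x))"
    using has_derivative_gradient[OF F] by simp
  from has_derivative_compose[OF d this]
  have 1: "((\<lambda>s. F (s *\<^sub>R x)) has_derivative (\<lambda>s. pairing (gradient F x) (s *\<^sub>R x))) (at 1)" .
  have 2: "((\<lambda>s. F (s *\<^sub>R x)) has_derivative (\<lambda>s. of_real s * (of_nat l * F x))) (at 1)"
    unfolding hom by (auto intro!: derivative_eq_intros)
  from has_derivative_unique[OF 1 2] have "pairing (gradient F x) (1 *\<^sub>R x) = of_real 1 * (of_nat l * F x)"
    by metis
  then show ?thesis by simp
qed

text \<open>
  The surface gradient is the tangential part of the spatial gradient, and Euler's identity determines
  the radial part that has to be removed.
\<close>

lemma is_surface_gradient_homogeneous:
  assumes n: "norm n = 1"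
    and F: "F differentiable at n" and hom: "\<And>s x. F (s *\<^sub>R x) = of_real s ^ l * F x"
    and eq: "\<And>x. norm x = 1 \<Longrightarrow> f x = F x"
  shows "is_surface_gradient f n (gradient F n - (of_nat l * f n) *s (\<chi> j. of_real (n $ j)))"
proof -
  define c u where "c = of_nat l * F n" and "u = gradient F n - c *s (\<chi> j. of_real (n $ j))"
  have position: "pairing (\<chi> j. of_real (n $ j)) h = of_real (n \<bullet> h)" for h
    by (simp add: pairing_def inner_vec_def)
  have u: "pairing u h = pairing (gradient F n) h - c * of_real (n \<bullet> h)" for h
  proof -
    have "gradient F n = u + c *s (\<chi> j. of_real (n $ j))" by (simp add: u_def)
    then show ?thesis by (simp add: pairing_add_left pairing_smult_left position)
  qed
  have "pairing u n = 0"
    using homogeneous_euler[OF F hom] n by (simp add: u c_def norm_eq_1)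
  moreover have "(f has_derivative pairing u) (at n within sphere 0 1)"
  proof -
    \<comment> \<open>\<open>g\<close> agrees with \<open>F\<close> on the sphere, and the differential of the correction removes the radial part.\<close>
    define g where "g x = F x - c * of_real ((x \<bullet> x - 1) / 2)" for x
    have "(g has_derivative pairing u) (at n)"
      unfolding g_def u
      by (auto intro!: derivative_eq_intros has_derivative_gradient[OF F] simp: inner_commute)
    then have "(g has_derivative pairing u) (at n within sphere 0 1)"
      by (rule has_derivative_at_withinI)
    then show ?thesis
      by (rule has_derivative_transform_within[OF _ zero_less_one])
         (use n in \<open>auto simp: g_def eq norm_eq_1\<close>)
  qed
  ultimately show ?thesis using eq[OF n] by (simp add: is_surface_gradient_def u_def c_def)
qed

lemma gradient_scaleR:
  assumes F: "F differentiable at x" and hom: "\<And>s x. F (s *\<^sub>R x) = of_real s ^ l * F x" and s: "s \<noteq> 0"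
  shows "gradient F (s *\<^sub>R x) = of_real s powi (int l - 1) *s gradient F x"
proof (rule gradient_eqI)
  have d: "((\<lambda>y. (1 / s) *\<^sub>R y) has_derivative (\<lambda>h. (1 / s) *\<^sub>R h)) (at (s *\<^sub>R x))"
    by (auto intro!: derivative_eq_intros)
  have "(F has_derivative pairing (gradient F x)) (at ((1 / s) *\<^sub>R (s *\<^sub>R x)))"
    using has_derivative_gradient[OF F] s by simp
  from has_derivative_mult_right[OF has_derivative_compose[OF d this], of "of_real s ^ l"]
  have "((\<lambda>y. of_real s ^ l * F ((1 / s) *\<^sub>R y)) has_derivative
      (\<lambda>h. of_real s ^ l * pairing (gradient F x) ((1 / s) *\<^sub>R h))) (at (s *\<^sub>R x))" .
  moreover have "of_real s ^ l * F ((1 / s) *\<^sub>R y) = F y" for y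
    using hom[of s "(1 / s) *\<^sub>R y"] s by simp
  moreover have "of_real s ^ l * pairing (gradient F x) ((1 / s) *\<^sub>R h)
      = pairing (of_real s powi (int l - 1) *s gradient F x) h" for h
    using s by (simp add: pairing_scaleR_right pairing_smult_left power_int_diff)
  ultimately show "(F has_derivative pairing (of_real s powi (int l - 1) *s gradient F x)) (at (s *\<^sub>R x))"
    by simp
qed

text \<open>
  At unit vectors the gradient is the vector harmonic, because the term \<open>l Y n\<close> restores the
  radial part; the gradient is homogeneous of degree \<open>l - 1\<close>, which gives the power of \<open>\<bar>r\<bar>\<close>.
\<close>

lemma gradient_homogeneous_eq_vector_harm:
  assumes r: "r \<noteq> 0"
    and F: "\<And>x. F differentiable at x" and hom: "\<And>s x. F (s *\<^sub>R x) = of_real s ^ l * F x"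
    and eq: "\<And>x. norm x = 1 \<Longrightarrow> f x = F x"
  shows "gradient F r = of_real (norm r) powi (int l - 1) *s vector_harm l f (sgn r)"
proof -
  have n: "norm (sgn r) = 1" using r by (simp add: norm_sgn)
  have "vector_harm l f (sgn r) = gradient F (sgn r)"
    using surface_gradient_eqI[OF n is_surface_gradient_homogeneous[OF n F hom eq]]
    by (simp add: vector_harm_def)
  moreover have "norm r *\<^sub>R sgn r = r" using r by (simp add: sgn_div_norm)
  ultimately show ?thesis
    using gradient_scaleR[OF F hom, of "norm r" "sgn r"] r by simp
qed

section \<open>Real and complex vector harmonics\<close>

lemma surface_gradient_lincomb:
  assumes "norm n = 1" "is_surface_gradient f n u" "is_surface_gradient g n v"
  shows "surface_gradient (\<lambda>x. c * f x + d * g x) n = c *s u + d *s v"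
proof (rule surface_gradient_eqI[OF assms(1)])
  show "is_surface_gradient (\<lambda>x. c * f x + d * g x) n (c *s u + d *s v)"
    using assms(2,3) unfolding is_surface_gradient_def pairing_add_left pairing_smult_left
    by (auto intro!: derivative_eq_intros)
qed

text \<open>
  Although the angular coordinates are singular at the poles, \<open>Y_l^m\<close> is the restriction of a polynomial
  to the whole sphere, and hence differentiable also there.
\<close>

lemma is_surface_gradient_sph_harm:
  assumes n: "norm n = 1" and m: "\<bar>m\<bar> \<le> int l"
  shows "is_surface_gradient (sph_harm l m) n (surface_gradient (sph_harm l m) n)"
proof -
  let ?F = "\<lambda>x. of_real (sqrt ((2 * real l + 1) / (4 * pi))) * harm_poly l m x"
  have "?F differentiable at n" by (intro differentiable_mult differentiable_const harm_poly_differentiable)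
  from is_surface_gradient_homogeneous[OF n this _ sph_harm_eq_harm_poly[OF _ m]]
  obtain v where "is_surface_gradient (sph_harm l m) n v" by (auto simp: harm_poly_scaleR)
  then show ?thesis using surface_gradient_eqI[OF n] by metis
qed

lemma vector_harm_lincomb:
  assumes "norm n = 1" "\<bar>m\<bar> \<le> int l" "\<bar>m'\<bar> \<le> int l"
  shows "vector_harm l (\<lambda>x. c * sph_harm l m x + d * sph_harm l m' x) n
    = c *s W_complex l m n + d *s W_complex l m' n"
  using surface_gradient_lincomb[OF assms(1) is_surface_gradient_sph_harm is_surface_gradient_sph_harm, of m l m' l c d] assms
  by (simp add: vector_harm_def W_complex_def vec_eq_iff algebra_simps)

lemma W_real_eq_W_complex:
  assumes n: "norm n = 1" and m: "\<bar>m\<bar> \<le> int l"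
  shows "m > 0 \<Longrightarrow> W_real l m n = (1 / of_real (sqrt 2)) *s W_complex l (- m) n
                                + ((-1) powi m / of_real (sqrt 2)) *s W_complex l m n"
    and "W_real l 0 n = W_complex l 0 n"
    and "m < 0 \<Longrightarrow> W_real l m n = (\<i> / of_real (sqrt 2)) *s W_complex l m n
                                + (- (\<i> / of_real (sqrt 2) * (-1) powi m)) *s W_complex l (- m) n"
proof -
  have m': "\<bar>- m\<bar> \<le> int l" using m by simp
  show "W_real l m n = (1 / of_real (sqrt 2)) *s W_complex l (- m) n
                                + ((-1) powi m / of_real (sqrt 2)) *s W_complex l m n" if "m > 0"
  proof -
    have "real_sph_harm l m = (\<lambda>x. 1 / of_real (sqrt 2) * sph_harm l (- m) x
        + ((-1) powi m / of_real (sqrt 2)) * sph_harm l m x)"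
      using that by (auto simp: real_sph_harm_def fun_eq_iff algebra_simps)
    then show ?thesis by (simp only: W_real_def vector_harm_lincomb[OF n m' m])
  qed
  have "real_sph_harm l 0 = sph_harm l 0" by (simp add: real_sph_harm_def fun_eq_iff)
  then show "W_real l 0 n = W_complex l 0 n" by (simp add: W_real_def W_complex_def)
  show "W_real l m n = (\<i> / of_real (sqrt 2)) *s W_complex l m n
      + (- (\<i> / of_real (sqrt 2) * (-1) powi m)) *s W_complex l (- m) n" if "m < 0"
  proof -
    have "real_sph_harm l m = (\<lambda>x. \<i> / of_real (sqrt 2) * sph_harm l m x
        + (- (\<i> / of_real (sqrt 2) * (-1) powi m)) * sph_harm l (- m) x)"
      using that by (auto simp: real_sph_harm_def fun_eq_iff algebra_simps)
    then show ?thesis by (simp only: W_real_def vector_harm_lincomb[OF n m m'])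
  qed
qed

lemma W_complex_eq_W_real:
  assumes n: "norm n = 1" and m: "\<bar>m\<bar> \<le> int l"
  shows "m < 0 \<Longrightarrow> W_complex l m n = (1 / of_real (sqrt 2)) *s (W_real l (- m) n - \<i> *s W_real l m n)"
    and "m > 0 \<Longrightarrow> W_complex l m n
      = ((-1) powi m / of_real (sqrt 2)) *s (W_real l m n + \<i> *s W_real l (- m) n)"
proof -
  define q s :: complex where "q = 1 / of_real (sqrt 2)" and "s = (-1) powi m"
  have "complex_of_real (sqrt 2) * of_real (sqrt 2) = 2" by (simp flip: of_real_mult)
  then have q: "q * q = 1 / 2" by (simp add: q_def)
  have s: "s * s = 1" by (simp add: s_def flip: power_int_mult_distrib)
  have s': "(-1) powi (- m) = s" by (simp only: s_def power_int_minus_one_minus)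
  have iq: "\<i> / of_real (sqrt 2) = \<i> * q" by (simp add: q_def)
  have sq: "s / of_real (sqrt 2) = s * q" by (simp add: q_def)
  note components = vector_add_component vector_minus_component vector_smult_component
  note q_s = s' s_def[symmetric] q_def[symmetric] iq sq minus_minus
  have m': "\<bar>- m\<bar> \<le> int l" using m by simp
  show "W_complex l m n = (1 / of_real (sqrt 2)) *s (W_real l (- m) n - \<i> *s W_real l m n)" if "m < 0"
  proof -
    have m'_pos: "- m > 0" using that by simp
    have "q * (q * w + s * q * w' - \<i> * (\<i> * q * w + - (\<i> * q * s) * w')) = 2 * (q * q) * w" for w w'
      by (simp add: algebra_simps)
    then show ?thesis
      unfolding W_real_eq_W_complex(3)[OF n m that] W_real_eq_W_complex(1)[OF n m' m'_pos] q_s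
      by (simp only: vec_eq_iff components q) simp
  qed
  show "W_complex l m n = ((-1) powi m / of_real (sqrt 2)) *s (W_real l m n + \<i> *s W_real l (- m) n)"
    if "m > 0"
  proof -
    have m'_neg: "- m < 0" using that by simp
    have "s * q * (q * w' + s * q * w + \<i> * (\<i> * q * w' + - (\<i> * q * s) * w))
        = 2 * (q * q) * (s * s) * w" for w w'
      by (simp add: algebra_simps)
    then show ?thesis
      unfolding W_real_eq_W_complex(1)[OF n m that] W_real_eq_W_complex(3)[OF n m' m'_neg] q_s
      by (simp only: vec_eq_iff components q s) simp
  qed
qed

section \<open>Translation of vector harmonics\<close>

lemma gradient_harm_poly:
  assumes "r \<noteq> 0" "\<bar>m\<bar> \<le> int l"
  shows "of_real (sqrt ((2 * real l + 1) / (4 * pi))) *s gradient (harm_poly l m) r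
    = of_real (norm r) powi (int l - 1) *s W_complex l m (sgn r)"
proof -
  let ?c = "complex_of_real (sqrt ((2 * real l + 1) / (4 * pi)))"
  let ?F = "\<lambda>x. ?c * harm_poly l m x"
  have "?F differentiable at x" for x
    by (intro differentiable_mult differentiable_const harm_poly_differentiable)
  then have "gradient ?F r = of_real (norm r) powi (int l - 1) *s W_complex l m (sgn r)"
    unfolding W_complex_def
    by (rule gradient_homogeneous_eq_vector_harm[OF assms(1)])
       (simp_all add: harm_poly_scaleR sph_harm_eq_harm_poly assms(2))
  moreover have "gradient ?F r = ?c *s gradient (harm_poly l m) r"
    by (intro gradient_eqI)
       (auto simp: pairing_smult_left intro!: derivative_eq_intros has_derivative_gradient harm_poly_differentiable)
  ultimately show ?thesis by simp
qed

lemma gradient_harm_poly_add: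
  assumes "\<bar>m\<bar> \<le> int l"
  shows "gradient (harm_poly l m) (r + a)
     = (\<Sum>k=1..l. \<Sum>\<mu>=-int k..int k.
          (of_real (sqrt (binom (int l + m) (int k + \<mu>) * binom (int l - m) (int k - \<mu>)))
          * harm_poly (l - k) (m - \<mu>) a) *s gradient (harm_poly k \<mu>) r)"
proof -
  let ?c = "\<lambda>k \<mu>. of_real (sqrt (binom (int l + m) (int k + \<mu>) * binom (int l - m) (int k - \<mu>)))
          * harm_poly (l - k) (m - \<mu>) a"
  let ?G = "\<lambda>k. \<Sum>\<mu>=-int k..int k. ?c k \<mu> *s gradient (harm_poly k \<mu>) r"
  have grad: "(harm_poly k \<mu> has_derivative pairing (gradient (harm_poly k \<mu>) x)) (at x)" for k \<mu> x
    by (intro has_derivative_gradient harm_poly_differentiable)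
  have "((\<lambda>x. x + a) has_derivative (\<lambda>h. h)) (at r)" by (auto intro!: derivative_eq_intros)
  from has_derivative_compose[OF this grad]
  have left: "((\<lambda>x. harm_poly l m (x + a)) has_derivative pairing (gradient (harm_poly l m) (r + a))) (at r)" .
  have right: "((\<lambda>x. harm_poly l m (x + a)) has_derivative pairing (\<Sum>k\<le>l. ?G k)) (at r)"
    unfolding harm_poly_add[OF assms] pairing_sum_left pairing_smult_left
    by (intro has_derivative_sum has_derivative_mult_right grad)
  have "gradient (harm_poly l m) (r + a) = (\<Sum>k\<le>l. ?G k)"
    by (rule trans[OF gradient_eqI[OF left, symmetric] gradient_eqI[OF right]])
  also have "gradient (harm_poly 0 \<mu>) r = 0" for \<mu>
  proof (rule gradient_eqI)
    have "pairing 0 = (\<lambda>h. 0)" by (simp add: pairing_def fun_eq_iff)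
    then show "(harm_poly 0 \<mu> has_derivative pairing 0) (at r)"
      unfolding harm_poly_degree_0[abs_def] by simp
  qed
  then have "(\<Sum>k\<le>l. ?G k) = (\<Sum>k=1..l. ?G k)"
    by (intro sum.mono_neutral_right) (auto simp: not_less_eq_eq)
  finally show ?thesis .
qed

text \<open>
  The gradient of the addition theorem.  The factor \<open>sqrt ((2 l + 1) / (2 k + 1))\<close> in the translation
  coefficients is the ratio of the normalisations of \<open>Y_l^m\<close> and \<open>Y_k^\<mu>\<close>.
\<close>

lemma W_complex_translation:
  assumes r: "r \<noteq> 0" and a: "a \<noteq> 0" and ra: "r + a \<noteq> 0" and m: "\<bar>m\<bar> \<le> int l"
  shows "of_real (norm (r + a)) powi (int l - 1) *s W_complex l m (sgn (r + a))
      = (\<Sum>k=1..l. \<Sum>\<mu>=-int k..int k.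
           (of_real (norm r) powi (int k - 1) * trans_coeff l k m \<mu> a) *s W_complex k \<mu> (sgn r))"
proof -
  let ?c = "\<lambda>l. sqrt ((2 * real l + 1) / (4 * pi))"
  let ?b = "\<lambda>k \<mu>. sqrt (binom (int l + m) (int k + \<mu>) * binom (int l - m) (int k - \<mu>))"
  have solid: "solid_harm j q a = harm_poly j q a" for j q
  proof (cases "\<bar>q\<bar> \<le> int j")
    case True
    have n: "norm (sgn a) = 1" using a by (simp add: norm_sgn)
    have one: "sqrt (4 * pi / (2 * real j + 1)) * ?c j = 1"
      by (simp flip: real_sqrt_mult)
    have "solid_harm j q a
      = of_real (sqrt (4 * pi / (2 * real j + 1)) * ?c j) * (of_real (norm a) ^ j * harm_poly j q (sgn a))"
      using True by (simp add: solid_harm_def sph_harm_eq_harm_poly[OF n] mult_ac)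
    also have "of_real (norm a) ^ j * harm_poly j q (sgn a) = harm_poly j q a"
      using a by (simp add: sgn_div_norm flip: harm_poly_scaleR)
    finally show ?thesis by (simp only: one of_real_1 mult_1)
  qed (simp add: solid_harm_def harm_poly_outside)
  have ratio: "?c l = sqrt ((2 * real l + 1) / (2 * real k + 1)) * ?c k" for k
    by (simp flip: real_sqrt_mult)
  have "of_real (norm (r + a)) powi (int l - 1) *s W_complex l m (sgn (r + a))
      = (\<Sum>k=1..l. \<Sum>\<mu>=-int k..int k.
          (of_real (?c l) * (of_real (?b k \<mu>) * harm_poly (l - k) (m - \<mu>) a)) *s gradient (harm_poly k \<mu>) r)"
    unfolding gradient_harm_poly[OF ra m, symmetric] gradient_harm_poly_add[OF m]
    by (simp add: vec.scale_sum_right)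
  also have "\<dots> = (\<Sum>k=1..l. \<Sum>\<mu>=-int k..int k.
          trans_coeff l k m \<mu> a *s (of_real (?c k) *s gradient (harm_poly k \<mu>) r))"
  proof (intro sum.cong refl)
    fix k \<mu>
    have "of_real (?c l) * (of_real (?b k \<mu>) * harm_poly (l - k) (m - \<mu>) a) = trans_coeff l k m \<mu> a * of_real (?c k)"
      unfolding ratio[of k] trans_coeff_def solid of_real_mult by (simp only: mult_ac)
    then show "(of_real (?c l) * (of_real (?b k \<mu>) * harm_poly (l - k) (m - \<mu>) a)) *s gradient (harm_poly k \<mu>) r
      = trans_coeff l k m \<mu> a *s (of_real (?c k) *s gradient (harm_poly k \<mu>) r)"
      by simp
  qed
  also have "\<dots> = (\<Sum>k=1..l. \<Sum>\<mu>=-int k..int k.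
           (of_real (norm r) powi (int k - 1) * trans_coeff l k m \<mu> a) *s W_complex k \<mu> (sgn r))"
  proof (intro sum.cong refl)
    fix k \<mu> assume "\<mu> \<in> {-int k..int k}"
    then have "\<bar>\<mu>\<bar> \<le> int k" by auto
    note grad = gradient_harm_poly[OF r this]
    show "trans_coeff l k m \<mu> a *s (of_real (?c k) *s gradient (harm_poly k \<mu>) r)
      = (of_real (norm r) powi (int k - 1) * trans_coeff l k m \<mu> a) *s W_complex k \<mu> (sgn r)"
      unfolding grad by (simp add: mult.commute)
  qed
  finally show ?thesis .
qed

theorem theorem3p2:
  fixes r a r' :: "real^3" and l :: nat and m :: int
  assumes "norm a > norm r" and "norm r > 0"
    and "r' = r + a"
    and "\<bar>m\<bar> \<le> int l"
  shows "(of_real (norm r') powi (int l - 1)) *s W_real l m (sgn r')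
      = (\<Sum>k=1..l. \<Sum>\<mu>=-int k..int k.
           (of_real (norm r) powi (int k - 1) * trans_coeff_real l k m \<mu> a)
             *s W_complex k \<mu> (sgn r))
    \<and> (\<Sum>k=1..l. \<Sum>\<mu>=-int k..int k.
           (of_real (norm r) powi (int k - 1) * trans_coeff_real l k m \<mu> a)
             *s W_complex k \<mu> (sgn r))
      = (\<Sum>k=1..l. (of_real (norm r) powi (int k - 1)) *s
           ((\<Sum>\<mu>=-int k..-1. (1 / of_real (sqrt 2) * trans_coeff_real l k m \<mu> a)
               *s (W_real k (- \<mu>) (sgn r) - \<i> *s W_real k \<mu> (sgn r)))
          + (\<Sum>\<mu>=1..int k. ((-1) powi \<mu> / of_real (sqrt 2) * trans_coeff_real l k m \<mu> a)
               *s (W_real k \<mu> (sgn r) + \<i> *s W_real k (- \<mu>) (sgn r)))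
          + trans_coeff_real l k m 0 a *s W_real k 0 (sgn r)))"
proof
  have r: "r \<noteq> 0" and a: "a \<noteq> 0" using assms(1,2) by auto
  have "norm (- a) \<noteq> norm r" using assms(1) by simp
  then have ra: "r + a \<noteq> 0" by (metis add_eq_0_iff2)
  have unit: "norm (sgn r) = 1" "norm (sgn r') = 1"
    using r ra assms(3) by (simp_all add: norm_sgn)
  let ?S = "\<lambda>c. \<Sum>k=1..l. \<Sum>\<mu>=-int k..int k.
           (of_real (norm r) powi (int k - 1) * c k \<mu>) *s W_complex k \<mu> (sgn r)"
  have S_lincomb: "?S (\<lambda>k \<mu>. x * c k \<mu> + y * d k \<mu>) = x *s ?S c + y *s ?S d"
    for x y :: complex and c d :: "nat \<Rightarrow> int \<Rightarrow> complex"
    by (simp add: vec_eq_iff sum_distrib_left sum.distrib algebra_simps)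
  have complex: "of_real (norm r') powi (int l - 1) *s W_complex l q (sgn r') = ?S (\<lambda>k \<mu>. trans_coeff l k q \<mu> a)"
    if "\<bar>q\<bar> \<le> int l" for q
    using W_complex_translation[OF r a ra that] by (simp add: assms(3))
  have lincomb: "of_real (norm r') powi (int l - 1) *s (x *s W_complex l q (sgn r') + y *s W_complex l q' (sgn r'))
      = ?S (\<lambda>k \<mu>. x * trans_coeff l k q \<mu> a + y * trans_coeff l k q' \<mu> a)"
    if "\<bar>q\<bar> \<le> int l" "\<bar>q'\<bar> \<le> int l" for q q' x y
    unfolding S_lincomb complex[OF that(1), symmetric] complex[OF that(2), symmetric]
    by (simp add: vec_eq_iff algebra_simps)
  have m': "\<bar>- m\<bar> \<le> int l" using assms(4) by simp
  consider "m > 0" | "m = 0" | "m < 0" by linarith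
  then show "of_real (norm r') powi (int l - 1) *s W_real l m (sgn r') = ?S (\<lambda>k \<mu>. trans_coeff_real l k m \<mu> a)"
  proof cases
    case 1
    let ?x = "1 / complex_of_real (sqrt 2)" and ?y = "(-1) powi m / complex_of_real (sqrt 2)"
    have "trans_coeff_real l k m \<mu> a = ?x * trans_coeff l k (- m) \<mu> a + ?y * trans_coeff l k m \<mu> a" for k \<mu>
      using 1 by (simp add: trans_coeff_real_def algebra_simps)
    then show ?thesis
      unfolding W_real_eq_W_complex(1)[OF unit(2) assms(4) 1] by (simp only: lincomb[OF m' assms(4)])
  next
    case 2
    then show ?thesis using complex[of 0]
      by (simp add: W_real_eq_W_complex(2)[OF unit(2) assms(4)] trans_coeff_real_def)
  next
    case 3
    let ?x = "\<i> / complex_of_real (sqrt 2)" and ?y = "- (\<i> / complex_of_real (sqrt 2) * (-1) powi m)"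
    have "trans_coeff_real l k m \<mu> a = ?x * trans_coeff l k m \<mu> a + ?y * trans_coeff l k (- m) \<mu> a" for k \<mu>
      using 3 by (simp add: trans_coeff_real_def algebra_simps)
    then show ?thesis
      unfolding W_real_eq_W_complex(3)[OF unit(2) assms(4) 3] by (simp only: lincomb[OF assms(4) m'])
  qed
  let ?A = "\<lambda>k \<mu>. trans_coeff_real l k m \<mu> a" and ?W = "\<lambda>k \<mu>. W_complex k \<mu> (sgn r)"
    and ?V = "\<lambda>k \<mu>. W_real k \<mu> (sgn r)"
  have "(\<Sum>\<mu>=-int k..int k. ?A k \<mu> *s ?W k \<mu>)
      = (\<Sum>\<mu>=-int k..-1. (1 / of_real (sqrt 2) * ?A k \<mu>) *s (?V k (- \<mu>) - \<i> *s ?V k \<mu>))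
      + (\<Sum>\<mu>=1..int k. ((-1) powi \<mu> / of_real (sqrt 2) * ?A k \<mu>) *s (?V k \<mu> + \<i> *s ?V k (- \<mu>)))
      + ?A k 0 *s ?V k 0" for k
  proof -
    have "{-int k..int k} = insert 0 ({-int k..-1} \<union> {1..int k})" by auto
    then have "(\<Sum>\<mu>=-int k..int k. ?A k \<mu> *s ?W k \<mu>)
      = (\<Sum>\<mu>=-int k..-1. ?A k \<mu> *s ?W k \<mu>) + (\<Sum>\<mu>=1..int k. ?A k \<mu> *s ?W k \<mu>) + ?A k 0 *s ?W k 0"
      by (simp add: sum.union_disjoint)
    also have "?W k 0 = ?V k 0" using W_real_eq_W_complex(2)[OF unit(1), of 0 k] by simp
    also have "(\<Sum>\<mu>=-int k..-1. ?A k \<mu> *s ?W k \<mu>)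
      = (\<Sum>\<mu>=-int k..-1. (1 / of_real (sqrt 2) * ?A k \<mu>) *s (?V k (- \<mu>) - \<i> *s ?V k \<mu>))"
    proof (rule sum.cong[OF refl])
      fix \<mu> assume "\<mu> \<in> {-int k..-1}"
      then have "\<bar>\<mu>\<bar> \<le> int k" "\<mu> < 0" by auto
      from W_complex_eq_W_real(1)[OF unit(1) this]
      show "?A k \<mu> *s ?W k \<mu> = (1 / of_real (sqrt 2) * ?A k \<mu>) *s (?V k (- \<mu>) - \<i> *s ?V k \<mu>)"
        by (simp only: vector_smult_assoc mult.commute)
    qed
    also have "(\<Sum>\<mu>=1..int k. ?A k \<mu> *s ?W k \<mu>)
      = (\<Sum>\<mu>=1..int k. ((-1) powi \<mu> / of_real (sqrt 2) * ?A k \<mu>) *s (?V k \<mu> + \<i> *s ?V k (- \<mu>)))"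
    proof (rule sum.cong[OF refl])
      fix \<mu> assume "\<mu> \<in> {1..int k}"
      then have "\<bar>\<mu>\<bar> \<le> int k" "\<mu> > 0" by auto
      from W_complex_eq_W_real(2)[OF unit(1) this]
      show "?A k \<mu> *s ?W k \<mu>
        = ((-1) powi \<mu> / of_real (sqrt 2) * ?A k \<mu>) *s (?V k \<mu> + \<i> *s ?V k (- \<mu>))"
        by (simp only: vector_smult_assoc mult.commute)
    qed
    finally show ?thesis .
  qed
  then show "?S ?A = (\<Sum>k=1..l. (of_real (norm r) powi (int k - 1)) *s
           ((\<Sum>\<mu>=-int k..-1. (1 / of_real (sqrt 2) * ?A k \<mu>) *s (?V k (- \<mu>) - \<i> *s ?V k \<mu>))
          + (\<Sum>\<mu>=1..int k. ((-1) powi \<mu> / of_real (sqrt 2) * ?A k \<mu>) *s (?V k \<mu> + \<i> *s ?V k (- \<mu>)))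
          + ?A k 0 *s ?V k 0))"
    by (simp only: vec.scale_sum_right[symmetric] vector_smult_assoc[symmetric])
qed

end
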